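(* Let $K>0$, $n\in(0,\infty]$, let $G=(V,w,m)$ be a finite measured weighted graph and $\rho\colon V\to\mathbb{R}$ a function such that $G$ has $(K,n,\rho)$-spectrally positive Ricci curvature, i.e. $G$ satisfies the variable curvature dimension condition $CD(\rho,n)$ and $$\tfrac12\langle Lf,f\rangle+\langle\rho f,f\rangle\ge K\langle f,f\rangle\quad\text{for all } f\colon V\to\mathbb{R}.$$ Then $\lambda(G)\ge K$, where $\lambda(G)$ is the first (smallest) positive eigenvalue of $L$ in $L^2(V)$.
   Context: A measured weighted graph (mwg) $G=(V,w,m)$ consists of a countable set $V$, a symmetric function $w\colon V\times V\to[0,\infty)$ vanishing on the diagonal, and a function $m\colon V\to(0,\infty)$. All mwg are assumed locally finite (for each $x\in V$ the set $\{y: w(x,y)>0\}$ is finite) and connected. It is finite if $V$ is finite. Write $q(x,y)=w(x,y)/m(x)$. $L^2(V)$ carries the inner product $\langle f,g\rangle=\sum_{x}m(x)f(x)g(x)$. For $f\colon V\to\mathbb{R}$ the Laplacian is $\Delta f(x)=\sum_{y}q(x,y)(f(y)-f(x))$, and $L=-\Delta\ge 0$. For bounded $f,g\colon V\to\mathbb{R}$: $\Gamma(f,g)=\frac12(\Delta(fg)-f\Delta g-g\Delta f)$ and $\Gamma_2(f,g)=\frac12(\Delta\Gamma(f,g)-\Gamma(f,\Delta g)-\Gamma(g,\Delta f))$; $\Gamma f:=\Gamma(f,f)$, $\Gamma_2f:=\Gamma_2(f,f)$. $G$ satisfies $CD(\rho,n)$, for $\rho\colon V\to\mathbb{R}$ and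 $n\in(0,\infty]$, if for all bounded $f\colon V\to\mathbb{R}$ and all $x\in V$: $\Gamma_2f(x)\ge\rho(x)\Gamma f(x)+\frac1n(\Delta f(x))^2$ (with $\frac1\infty=0$). *)

theory Defs
  imports "HOL-Analysis.Analysis"
begin

text \<open>
  Functions on the vertex set are total functions on the vertex type. Every notion below
  looks at their values on \<open>verts G\<close> only, so values elsewhere play no role.
\<close>

record 'v mwg =
  verts :: "'v set"
  weight :: "'v \<Rightarrow> 'v \<Rightarrow> real"
  mass :: "'v \<Rightarrow> real"

definition neighbours :: "'v mwg \<Rightarrow> 'v \<Rightarrow> 'v set" where
  "neighbours G x = {y \<in> verts G. weight G x y > 0}"

definition adj_rel :: "'v mwg \<Rightarrow> ('v \<times> 'v) set" where
  "adj_rel G = {(x, y). x \<in> verts G \<and> y \<in> neighbours G x}"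

locale measured_weighted_graph =
  fixes G :: "'v mwg"
  assumes countable_verts: "countable (verts G)"
    and weight_nonneg: "\<And>x y. x \<in> verts G \<Longrightarrow> y \<in> verts G \<Longrightarrow> weight G x y \<ge> 0"
    and weight_sym: "\<And>x y. x \<in> verts G \<Longrightarrow> y \<in> verts G \<Longrightarrow> weight G x y = weight G y x"
    and weight_diag: "\<And>x. x \<in> verts G \<Longrightarrow> weight G x x = 0"
    and mass_pos: "\<And>x. x \<in> verts G \<Longrightarrow> mass G x > 0"
    and locally_finite: "\<And>x. x \<in> verts G \<Longrightarrow> finite (neighbours G x)"
    and connected: "\<And>x y. x \<in> verts G \<Longrightarrow> y \<in> verts G \<Longrightarrow> (x, y) \<in> (adj_rel G)\<^sup>*"

locale finite_measured_weighted_graph = measured_weighted_graph +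
  assumes finite_verts: "finite (verts G)"

definition jump_rate :: "'v mwg \<Rightarrow> 'v \<Rightarrow> 'v \<Rightarrow> real" where
  "jump_rate G x y = weight G x y / mass G x"

definition inner_L2 :: "'v mwg \<Rightarrow> ('v \<Rightarrow> real) \<Rightarrow> ('v \<Rightarrow> real) \<Rightarrow> real" where
  "inner_L2 G f g = (\<Sum>\<^sub>\<infinity>x\<in>verts G. mass G x * f x * g x)"

definition space_L2 :: "'v mwg \<Rightarrow> ('v \<Rightarrow> real) set" where
  "space_L2 G = {f. (\<lambda>x. mass G x * (f x)\<^sup>2) summable_on verts G}"

text \<open>
  The sum over all vertices \<open>y\<close> reduces to the neighbours, since \<open>weight G x y = 0\<close>
  for every other \<open>y\<close>.
\<close>

definition laplacian :: "'v mwg \<Rightarrow> ('v \<Rightarrow> real) \<Rightarrow> 'v \<Rightarrow> real" where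
  "laplacian G f x = (\<Sum>y\<in>neighbours G x. jump_rate G x y * (f y - f x))"

definition neg_laplacian :: "'v mwg \<Rightarrow> ('v \<Rightarrow> real) \<Rightarrow> 'v \<Rightarrow> real" where
  "neg_laplacian G f x = - laplacian G f x"

definition Gamma :: "'v mwg \<Rightarrow> ('v \<Rightarrow> real) \<Rightarrow> ('v \<Rightarrow> real) \<Rightarrow> 'v \<Rightarrow> real" where
  "Gamma G f g x =
     1/2 * (laplacian G (\<lambda>y. f y * g y) x - f x * laplacian G g x - g x * laplacian G f x)"

definition Gamma2 :: "'v mwg \<Rightarrow> ('v \<Rightarrow> real) \<Rightarrow> ('v \<Rightarrow> real) \<Rightarrow> 'v \<Rightarrow> real" where
  "Gamma2 G f g x =
     1/2 * (laplacian G (Gamma G f g) x - Gamma G f (laplacian G g) x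
            - Gamma G g (laplacian G f) x)"

text \<open>
  The dimension \<open>n\<close> ranges over \<open>(0, \<infinity>]\<close>; in \<^typ>\<open>ereal\<close>, \<open>1 / \<infinity> = 0\<close>.
\<close>

definition CD :: "'v mwg \<Rightarrow> ('v \<Rightarrow> real) \<Rightarrow> ereal \<Rightarrow> bool" where
  "CD G \<rho> n \<longleftrightarrow>
     (\<forall>f x. bounded (f ` verts G) \<longrightarrow> x \<in> verts G \<longrightarrow>
        Gamma2 G f f x \<ge> \<rho> x * Gamma G f f x + real_of_ereal (1 / n) * (laplacian G f x)\<^sup>2)"

definition spectrally_positive_Ricci ::
    "'v mwg \<Rightarrow> real \<Rightarrow> ereal \<Rightarrow> ('v \<Rightarrow> real) \<Rightarrow> bool" where
  "spectrally_positive_Ricci G K n \<rho> \<longleftrightarrow>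
     CD G \<rho> n \<and>
     (\<forall>f. 1/2 * inner_L2 G (neg_laplacian G f) f + inner_L2 G (\<lambda>x. \<rho> x * f x) f
            \<ge> K * inner_L2 G f f)"

definition is_eigenvalue :: "'v mwg \<Rightarrow> real \<Rightarrow> bool" where
  "is_eigenvalue G l \<longleftrightarrow>
     (\<exists>f \<in> space_L2 G. (\<exists>x\<in>verts G. f x \<noteq> 0) \<and>
        (\<forall>x\<in>verts G. neg_laplacian G f x = l * f x))"

text \<open>
  The smallest positive eigenvalue of a finite graph, with value \<open>\<infinity>\<close> if there is none. A
  finite connected graph without positive eigenvalues has at most one vertex; with two or
  more vertices the eigenvalues form a finite set containing a positive number, and
  the least element below exists.
\<close>

definition first_eigenvalue :: "'v mwg \<Rightarrow> ereal" where
  "first_eigenvalue G =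
     (if \<exists>l>0. is_eigenvalue G l then ereal (LEAST l. l > 0 \<and> is_eigenvalue G l) else \<infinity>)"

end

theory Submission
  imports Defs
begin

text \<open>
  Let \<open>f\<close> be an eigenfunction of \<open>L\<close> for a positive eigenvalue \<open>\<lambda>\<close>, and put \<open>u = \<Gamma> f\<close>. Since
  \<open>\<Gamma>(f, \<Delta> f) = - \<lambda> u\<close>, the curvature dimension condition, evaluated at \<open>f\<close>, becomes the
  pointwise inequality \<open>1/2 \<Delta> u + \<lambda> u \<ge> \<rho> u\<close>. As \<open>u \<ge> 0\<close>, multiplying by \<open>u\<close> and
  summing against the mass preserves the inequality:
  \<open>1/2 \<langle>L u, u\<rangle> + \<langle>\<rho> u, u\<rangle> \<le> \<lambda> \<langle>u, u\<rangle>\<close>. The spectral positivity assumption, tested on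
  the same \<open>u\<close>, bounds the left side below by \<open>K \<langle>u, u\<rangle>\<close>. Finally \<open>u\<close> does not
  vanish identically: where \<open>\<Gamma> f = 0\<close> the function \<open>f\<close> agrees with its values at all neighbours, so that
  \<open>\<lambda> f = L f = 0\<close> there. Hence \<open>\<lambda> \<ge> K\<close> (\<open>eigenvalue_ge_of_spectrally_positive_Ricci\<close>).

  To pass from all positive eigenvalues to the least one, that least one has to exist. This follows
  from the finiteness of the spectrum (\<open>finite_eigenvalues\<close>): eigenfunctions for distinct eigenvalues
  are orthogonal, and Bessel's inequality bounds the size of an orthonormal family by the number
  of vertices.
\<close>

section \<open>The carre du champ operator\<close>

lemma laplacian_cmult: "laplacian G (\<lambda>y. c * f y) x = c * laplacian G f x"
  by (simp add: laplacian_def sum_distrib_left algebra_simps)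

lemma Gamma_eq_sum:
  "Gamma G f g x = 1/2 * (\<Sum>y\<in>neighbours G x. jump_rate G x y * ((f y - f x) * (g y - g x)))"
  by (simp add: Gamma_def laplacian_def sum_distrib_left sum_subtractf [symmetric] algebra_simps)

lemma Gamma_cong_right:
  assumes "x \<in> verts G" "\<And>y. y \<in> verts G \<Longrightarrow> g y = h y"
  shows "Gamma G f g x = Gamma G f h x"
  using assms unfolding Gamma_eq_sum neighbours_def by simp

lemma Gamma_cmult_right: "Gamma G f (\<lambda>y. c * g y) x = c * Gamma G f g x"
  by (simp add: Gamma_eq_sum sum_distrib_left algebra_simps)

context measured_weighted_graph
begin

lemma jump_rate_pos:
  assumes "x \<in> verts G" "y \<in> neighbours G x"
  shows "jump_rate G x y > 0"
  using assms mass_pos by (simp add: jump_rate_def neighbours_def)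

lemma Gamma_nonneg:
  assumes "x \<in> verts G"
  shows "Gamma G f f x \<ge> 0"
proof -
  have "jump_rate G x y * ((f y - f x) * (f y - f x)) \<ge> 0" if "y \<in> neighbours G x" for y
    using jump_rate_pos [OF assms that] by simp
  then show ?thesis
    by (simp add: Gamma_eq_sum sum_nonneg)
qed

lemma laplacian_eq_0_if_Gamma_eq_0:
  assumes x: "x \<in> verts G" and "Gamma G f f x = 0"
  shows "laplacian G f x = 0"
proof -
  have "(\<Sum>y\<in>neighbours G x. jump_rate G x y * ((f y - f x) * (f y - f x))) = 0"
    using assms(2) by (simp add: Gamma_eq_sum)
  then have "\<forall>y\<in>neighbours G x. jump_rate G x y * ((f y - f x) * (f y - f x)) = 0"
    by (subst (asm) sum_nonneg_eq_0_iff)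
      (auto simp: locally_finite x less_imp_le jump_rate_pos)
  then have "\<forall>y\<in>neighbours G x. f y - f x = 0"
    using jump_rate_pos [OF x] by force
  then show ?thesis
    by (simp add: laplacian_def)
qed

end

section \<open>Finiteness of the spectrum\<close>

context finite_measured_weighted_graph
begin

lemma inner_L2_eq_sum: "inner_L2 G f g = (\<Sum>x\<in>verts G. mass G x * f x * g x)"
  unfolding inner_L2_def by (rule infsum_finite [OF finite_verts])

lemma inner_L2_self_pos:
  assumes "x \<in> verts G" "f x \<noteq> 0"
  shows "inner_L2 G f f > 0"
proof -
  have "0 < mass G x * f x * f x"
    using assms by (simp add: mult.assoc mass_pos zero_less_mult_iff linorder_neq_iff) blast
  then show ?thesis
    unfolding inner_L2_eq_sum
    by (rule sum_pos2 [OF finite_verts assms(1)])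
      (simp add: mult.assoc mass_pos less_imp_le)
qed

text \<open>
  The factor \<open>mass G x\<close> cancels the one in the jump rate. What is left is a sum over pairs of
  vertices with the symmetric kernel \<open>weight\<close>, which is why \<open>L\<close> is self-adjoint.
\<close>

lemma mass_laplacian:
  assumes x: "x \<in> verts G"
  shows "mass G x * laplacian G f x = (\<Sum>y\<in>verts G. weight G x y * (f y - f x))"
proof -
  have "mass G x * laplacian G f x = (\<Sum>y\<in>neighbours G x. weight G x y * (f y - f x))"
    using mass_pos [OF x] by (simp add: laplacian_def sum_distrib_left jump_rate_def)
  also have "\<dots> = (\<Sum>y\<in>verts G. weight G x y * (f y - f x))"
    using weight_nonneg [OF x]
    by (intro sum.mono_neutral_left) (auto simp: finite_verts neighbours_def order.antisym not_less)
  finally show ?thesis .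
qed

lemma neg_laplacian_self_adjoint:
  "inner_L2 G (neg_laplacian G f) g = inner_L2 G f (neg_laplacian G g)"
proof -
  have left: "inner_L2 G (neg_laplacian G f) g =
      (\<Sum>x\<in>verts G. \<Sum>y\<in>verts G. weight G x y * f x * g x)
      - (\<Sum>x\<in>verts G. \<Sum>y\<in>verts G. weight G x y * f y * g x)" for f g
  proof -
    have "inner_L2 G (neg_laplacian G f) g = (\<Sum>x\<in>verts G. - (mass G x * laplacian G f x) * g x)"
      by (simp add: inner_L2_eq_sum neg_laplacian_def)
    also have "\<dots> = (\<Sum>x\<in>verts G. \<Sum>y\<in>verts G.
        weight G x y * f x * g x - weight G x y * f y * g x)"
      by (rule sum.cong)
        (simp_all add: mass_laplacian sum_negf [symmetric] sum_distrib_right left_diff_distrib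
          right_diff_distrib)
    finally show ?thesis
      by (simp add: sum_subtractf)
  qed
  have "(\<Sum>x\<in>verts G. \<Sum>y\<in>verts G. weight G x y * f y * g x)
      = (\<Sum>x\<in>verts G. \<Sum>y\<in>verts G. weight G x y * g y * f x)"
    by (subst sum.swap, intro sum.cong) (auto simp: weight_sym)
  moreover have "inner_L2 G f (neg_laplacian G g) = inner_L2 G (neg_laplacian G g) f"
    by (simp add: inner_L2_eq_sum mult.commute mult.left_commute)
  ultimately show ?thesis
    by (simp add: left mult.commute mult.left_commute)
qed

lemma eigenfunctions_orthogonal:
  assumes "\<forall>x\<in>verts G. neg_laplacian G f x = k * f x"
    and "\<forall>x\<in>verts G. neg_laplacian G g x = l * g x"
    and "k \<noteq> l"
  shows "inner_L2 G f g = 0"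
proof -
  have "k * inner_L2 G f g = inner_L2 G (neg_laplacian G f) g"
    using assms(1) by (simp add: inner_L2_eq_sum sum_distrib_left algebra_simps)
  also have "\<dots> = inner_L2 G f (neg_laplacian G g)"
    by (rule neg_laplacian_self_adjoint)
  also have "\<dots> = l * inner_L2 G f g"
    using assms(2) by (simp add: inner_L2_eq_sum sum_distrib_left algebra_simps)
  finally show ?thesis
    using assms(3) by simp
qed

text \<open>
  Bessel's inequality for the indicator of a vertex \<open>z\<close>: the squared norm of that indicator is
  \<open>mass G z\<close>, and its coefficient along \<open>e i\<close> is \<open>mass G z * e i z\<close>; one factor \<open>mass G z\<close> has
  been cancelled. The reason is that the kernel \<open>p\<close> of the projection onto the span of the
  family, taken at \<open>z\<close>, has squared norm \<open>p z\<close>, and the vertex \<open>z\<close> alone contributes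
  \<open>mass G z * (p z)\<^sup>2\<close> to that norm.
\<close>

lemma Bessel_at_vertex:
  assumes I: "finite I" and z: "z \<in> verts G"
    and ortho: "\<And>i j. i \<in> I \<Longrightarrow> j \<in> I \<Longrightarrow> inner_L2 G (e i) (e j) = (if i = j then 1 else 0)"
  shows "(\<Sum>i\<in>I. mass G z * (e i z)\<^sup>2) \<le> 1"
proof -
  define p where "p x = (\<Sum>i\<in>I. e i z * e i x)" for x
  \<comment> \<open>The projection of the indicator onto the span of the family is \<open>mass G z * p x\<close>.\<close>
  have pp: "(\<Sum>x\<in>verts G. mass G x * p x * p x) = p z"
  proof -
    have "(\<Sum>x\<in>verts G. mass G x * p x * p x)
        = (\<Sum>x\<in>verts G. \<Sum>i\<in>I. \<Sum>j\<in>I. e i z * e j z * (mass G x * e i x * e j x))"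
      unfolding p_def by (simp add: sum_distrib_left sum_distrib_right algebra_simps)
    also have "\<dots> = (\<Sum>i\<in>I. \<Sum>x\<in>verts G. \<Sum>j\<in>I. e i z * e j z * (mass G x * e i x * e j x))"
      by (rule sum.swap)
    also have "\<dots> = (\<Sum>i\<in>I. \<Sum>j\<in>I. \<Sum>x\<in>verts G. e i z * e j z * (mass G x * e i x * e j x))"
      by (intro sum.cong refl sum.swap)
    also have "\<dots> = (\<Sum>i\<in>I. \<Sum>j\<in>I. e i z * e j z * inner_L2 G (e i) (e j))"
      by (simp add: inner_L2_eq_sum sum_distrib_left)
    also have "\<dots> = (\<Sum>i\<in>I. \<Sum>j\<in>I. if i = j then e i z * e j z else 0)"
      by (intro sum.cong) (auto simp: ortho)
    also have "\<dots> = p z"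
      using I by (simp add: p_def)
    finally show ?thesis .
  qed
  have "mass G z * p z * p z \<le> (\<Sum>x\<in>verts G. mass G x * p x * p x)"
    by (rule member_le_sum [OF z]) (simp_all add: finite_verts mult.assoc mass_pos less_imp_le)
  then have "(mass G z * p z) * p z \<le> 1 * p z"
    by (simp add: pp)
  moreover have "p z \<ge> 0"
    by (simp add: p_def sum_nonneg)
  ultimately have "mass G z * p z \<le> 1"
    by (cases "p z = 0") (auto simp: mult_le_cancel_right)
  then show ?thesis
    by (simp add: p_def sum_distrib_left power2_eq_square)
qed

lemma card_orthonormal_le:
  assumes I: "finite I"
    and ortho: "\<And>i j. i \<in> I \<Longrightarrow> j \<in> I \<Longrightarrow> inner_L2 G (e i) (e j) = (if i = j then 1 else 0)"
  shows "card I \<le> card (verts G)"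
proof -
  have "real (card I) = (\<Sum>i\<in>I. inner_L2 G (e i) (e i))"
    by (simp add: ortho)
  also have "\<dots> = (\<Sum>z\<in>verts G. \<Sum>i\<in>I. mass G z * (e i z)\<^sup>2)"
    unfolding inner_L2_eq_sum by (subst sum.swap) (simp add: power2_eq_square mult.assoc)
  also have "\<dots> \<le> (\<Sum>z\<in>verts G. 1)"
    by (intro sum_mono Bessel_at_vertex I ortho)
  finally show ?thesis
    by simp
qed

lemma eigenvalue_has_unit_eigenfunction:
  assumes "is_eigenvalue G l"
  shows "\<exists>f. inner_L2 G f f = 1 \<and> (\<forall>x\<in>verts G. neg_laplacian G f x = l * f x)"
proof -
  obtain f x where x: "x \<in> verts G" "f x \<noteq> 0"
    and f: "\<forall>x\<in>verts G. neg_laplacian G f x = l * f x"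
    using assms by (auto simp: is_eigenvalue_def)
  define c where "c = inverse (sqrt (inner_L2 G f f))"
  have pos: "inner_L2 G f f > 0"
    using x by (rule inner_L2_self_pos)
  have "inner_L2 G (\<lambda>x. c * f x) (\<lambda>x. c * f x) = c * c * inner_L2 G f f"
    by (simp add: inner_L2_eq_sum sum_distrib_left algebra_simps)
  also have "\<dots> = 1"
    using pos by (simp add: c_def field_simps)
  finally have "inner_L2 G (\<lambda>x. c * f x) (\<lambda>x. c * f x) = 1" .
  moreover have "\<forall>x\<in>verts G. neg_laplacian G (\<lambda>x. c * f x) x = l * (c * f x)"
    using f by (simp add: neg_laplacian_def laplacian_cmult minus_mult_right del: mult_minus_right)
  ultimately show ?thesis
    by blast
qed

lemma finite_eigenvalues: "finite {l. is_eigenvalue G l}"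
proof (rule ccontr)
  assume "infinite {l. is_eigenvalue G l}"
  then obtain I where I: "finite I" "card I = Suc (card (verts G))" "I \<subseteq> {l. is_eigenvalue G l}"
    using infinite_arbitrarily_large by blast
  obtain e where e: "\<And>l. l \<in> I \<Longrightarrow> inner_L2 G (e l) (e l) = 1"
    "\<And>l. l \<in> I \<Longrightarrow> \<forall>x\<in>verts G. neg_laplacian G (e l) x = l * e l x"
    using eigenvalue_has_unit_eigenfunction I(3) by (metis mem_Collect_eq subsetD)
  have "card I \<le> card (verts G)"
    by (rule card_orthonormal_le [OF I(1), of e])
      (auto simp: e(1) intro: eigenfunctions_orthogonal [OF e(2) e(2)])
  with I(2) show False
    by simp
qed

lemma first_eigenvalue_geI:
  assumes "\<And>l. l > 0 \<Longrightarrow> is_eigenvalue G l \<Longrightarrow> K \<le> l"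
  shows "ereal K \<le> first_eigenvalue G"
proof (cases "\<exists>l>0. is_eigenvalue G l")
  case True
  define S where "S = {l. l > 0 \<and> is_eigenvalue G l}"
  have S: "finite S" "S \<noteq> {}"
    using True finite_subset [OF _ finite_eigenvalues, of S] by (auto simp: S_def)
  \<comment> \<open>On the reals \<open>LEAST\<close> is meaningful only when the minimum is attained.\<close>
  have "(LEAST l. l > 0 \<and> is_eigenvalue G l) = Min S"
    using Least_Min [of "\<lambda>l. l > 0 \<and> is_eigenvalue G l"] S by (simp add: S_def)
  moreover have "Min S \<in> S"
    by (rule Min_in [OF S])
  ultimately show ?thesis
    using True assms by (simp add: first_eigenvalue_def S_def)
next
  case False
  then have "first_eigenvalue G = \<infinity>"
    unfolding first_eigenvalue_def by (rule if_not_P)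
  then show ?thesis
    by simp
qed

end

section \<open>The eigenvalue bound\<close>

text \<open>
  On an eigenfunction \<open>\<Gamma>(f, \<Delta> f)\<close> collapses to \<open>- l * \<Gamma> f\<close>, so \<open>\<Gamma>\<^sub>2 f\<close> depends on \<open>f\<close> only through
  \<open>\<Gamma> f\<close>, and the curvature bound becomes linear in \<open>\<Gamma> f\<close> once the dimension term,
  nonnegative for \<open>n > 0\<close>, is dropped.
\<close>

lemma (in finite_measured_weighted_graph) Gamma_eigenfunction_subsolution:
  assumes "CD G \<rho> n" "n > 0"
    and f: "\<forall>x\<in>verts G. neg_laplacian G f x = l * f x"
    and x: "x \<in> verts G"
  shows "1/2 * neg_laplacian G (Gamma G f f) x + \<rho> x * Gamma G f f x \<le> l * Gamma G f f x"
proof -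
  have "Gamma G f (laplacian G f) x = Gamma G f (\<lambda>y. (- l) * f y) x"
    using f by (intro Gamma_cong_right x) (auto simp: neg_laplacian_def)
  then have Gamma_Delta: "Gamma G f (laplacian G f) x = - l * Gamma G f f x"
    by (simp only: Gamma_cmult_right)
  have "bounded (f ` verts G)"
    by (simp add: finite_imp_bounded finite_verts)
  then have "Gamma2 G f f x \<ge> \<rho> x * Gamma G f f x + real_of_ereal (1 / n) * (laplacian G f x)\<^sup>2"
    using assms(1) x by (simp add: CD_def)
  moreover have "real_of_ereal (1 / n) * (laplacian G f x)\<^sup>2 \<ge> 0"
    using assms(2) by (intro mult_nonneg_nonneg real_of_ereal_pos) auto
  ultimately have "Gamma2 G f f x \<ge> \<rho> x * Gamma G f f x"
    by linarith
  then show ?thesis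
    by (simp add: Gamma2_def Gamma_Delta neg_laplacian_def)
qed

lemma (in finite_measured_weighted_graph) eigenvalue_ge_of_spectrally_positive_Ricci:
  assumes "spectrally_positive_Ricci G K n \<rho>" "n > 0" "l > 0" "is_eigenvalue G l"
  shows "K \<le> l"
proof -
  obtain f z where z: "z \<in> verts G" "f z \<noteq> 0"
    and f: "\<forall>x\<in>verts G. neg_laplacian G f x = l * f x"
    using assms(4) by (auto simp: is_eigenvalue_def)
  define u where "u = Gamma G f f"
  have "K * inner_L2 G u u \<le> 1/2 * inner_L2 G (neg_laplacian G u) u + inner_L2 G (\<lambda>x. \<rho> x * u x) u"
    using assms(1) by (simp add: spectrally_positive_Ricci_def)
  also have "\<dots> = (\<Sum>x\<in>verts G. mass G x * u x * (1/2 * neg_laplacian G u x + \<rho> x * u x))"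
    by (simp add: inner_L2_eq_sum sum_distrib_left sum.distrib [symmetric] algebra_simps)
  also have "\<dots> \<le> (\<Sum>x\<in>verts G. mass G x * u x * (l * u x))"
  proof (intro sum_mono mult_left_mono)
    fix x
    assume x: "x \<in> verts G"
    show "1/2 * neg_laplacian G u x + \<rho> x * u x \<le> l * u x"
      unfolding u_def
      using Gamma_eigenfunction_subsolution [OF _ assms(2) f x] assms(1)
      by (simp add: spectrally_positive_Ricci_def)
    show "0 \<le> mass G x * u x"
      using mass_pos [OF x] Gamma_nonneg [OF x] by (simp add: u_def)
  qed
  also have "\<dots> = l * inner_L2 G u u"
    by (simp add: inner_L2_eq_sum sum_distrib_left algebra_simps)
  finally have "K * inner_L2 G u u \<le> l * inner_L2 G u u" .
  moreover have "u z \<noteq> 0"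
    using laplacian_eq_0_if_Gamma_eq_0 [OF z(1), of f] f z assms(3)
    by (auto simp: u_def neg_laplacian_def)
  then have "inner_L2 G u u > 0"
    using z(1) by (intro inner_L2_self_pos)
  ultimately show ?thesis
    by simp
qed

theorem theorem3p1:
  fixes G :: "'v mwg" and K :: real and n :: ereal and \<rho> :: "'v \<Rightarrow> real"
  assumes "finite_measured_weighted_graph G"
    and "K > 0" and "n > 0"
    and "spectrally_positive_Ricci G K n \<rho>"
  shows "first_eigenvalue G \<ge> ereal K"
proof -
  interpret finite_measured_weighted_graph G
    by (rule assms(1))
  show ?thesis
    using first_eigenvalue_geI eigenvalue_ge_of_spectrally_positive_Ricci [OF assms(4,3)] by blast
qed

end
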